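(* Suppose that smooth functions $f_3=f_3(x,p_0,p_1,p_2,p_3)$, $L_2=L_2(x,p_0,p_1,p_2)$ and a positive smooth function $\rho_2=\rho_2(x,p_0,p_1,p_2)$ satisfy $$\rho_2\,(p_4-f_3)=E_4^2L_2\qquad(\ast)$$ for all $(x,p_0,p_1,p_2,p_3,p_4)$. Then there are smooth functions $R_2=R_2(x,p_0,p_1,p_2)$, $f_0=f_0(x,p_0)$, $f_1=f_1(x,p_0,p_1)$ and $N_1=N_1(x,p_0,p_1)$ such that $$\left\{\begin{array}{rcl} f_3 &=& \displaystyle \partial_2R_2\cdot p_3^2+2D_2R_2\cdot p_3-e^{R_2}\left(E_2^2\int^{p_2}\!\!\!\int e^{-R_2}+f_1p_2-E_1^1\int^{p_1}\!\!\!\int f_1+f_0\right),\\ \rho_2&=&e^{-R_2},\\ L_2&=&\displaystyle\int^{p_2}\!\!\!\int e^{-R_2}-\int^{p_1}\!\!\!\int f_1+\int^{p_0}f_0+D_2N_1. \end{array}\right.$$ Conversely, given any smooth functions $R_2(x,p_0,p_1,p_2)$, $f_0(x,p_0)$, $f_1(x,p_0,p_1)$ and $N_1(x,p_0,p_1)$, the functions $f_3$, $L_2$ and $\rho_2$ defined by these formulas satisfy $(\ast)$.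
   Context: The variables $x,p_0,p_1,p_2,\dots$ are independent real variables and all functions are smooth. The subscript of a function denotes the highest $p$-variable it may depend on: $F_k=F_k(x,p_0,\dots,p_k)$. Write $\partial_k=\partial/\partial p_k$ and $\partial_x=\partial/\partial x$. Truncated total differential operators: $D_0:=\partial_x$ and $D_m:=\partial_x+p_1\partial_0+p_2\partial_1+\cdots+p_m\partial_{m-1}$ for $m\ge1$. Euler--Lagrange operators: $E_m^n:=\sum_{k=0}^n(-1)^kD_m^k\partial_k$ for $m,n\ge0$, where in $D_m^k$ the superscript is a power (composition), while in $E_m^n$ it is only an index. Antiderivatives: for smooth $F$, $$\int^{p_k}F:=\int_0^{p_k}F(x,p_0,\dots,p_{k-1},\tilde p_k,p_{k+1},\dots)\,d\tilde p_k,\qquad \int^{p_k}\!\!\!\int F:=\int_0^{p_k}\!\!\int_0^{\tilde p_k}F(x,p_0,\dots,p_{k-1},\hat p_k,p_{k+1},\dots)\,d\hat p_k\,d\tilde p_k.$$ *)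

theory Defs
  imports "HOL-Analysis.Analysis"
begin

text \<open>
  A point of the jet space assigns a real value to each of the independent variables
  \<open>x\<close> (\<open>VX\<close>) and \<open>p\<^sub>0, p\<^sub>1, \<dots>\<close> (\<open>VP 0, VP 1, \<dots>\<close>).
  All functions live on this common space; \<open>F\<^sub>k\<close> is a function whose value does not change with
  the coordinates \<open>VP i\<close> for \<open>i > k\<close>.
\<close>

datatype jet_var = VX | VP nat

type_synonym jet = "jet_var \<Rightarrow> real"

definition pdiff :: "jet_var \<Rightarrow> (jet \<Rightarrow> real) \<Rightarrow> jet \<Rightarrow> real" where
  "pdiff v F u = deriv (\<lambda>t. F (u(v := t))) (u v)"

primrec pdiffs :: "jet_var list \<Rightarrow> (jet \<Rightarrow> real) \<Rightarrow> jet \<Rightarrow> real" where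
  "pdiffs [] F = F"
| "pdiffs (v # vs) F = pdiff v (pdiffs vs F)"

definition depends_upto :: "nat \<Rightarrow> (jet \<Rightarrow> real) \<Rightarrow> bool" where
  "depends_upto k F \<longleftrightarrow>
     (\<forall>u w. u VX = w VX \<and> (\<forall>i\<le>k. u (VP i) = w (VP i)) \<longrightarrow> F u = F w)"

text \<open>
  Smooth function of \<open>x, p\<^sub>0, \<dots>, p\<^sub>k\<close>: all iterated partial derivatives exist and are continuous.
  Continuity on \<open>jet\<close> is with respect to the product topology; for a function of finitely many
  coordinates this is continuity on the corresponding Euclidean space.
\<close>

definition smooth_fun :: "nat \<Rightarrow> (jet \<Rightarrow> real) \<Rightarrow> bool" where
  "smooth_fun k F \<longleftrightarrow> depends_upto k F \<and>
     (\<forall>vs. continuous_on UNIV (pdiffs vs F) \<and>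
           (\<forall>v u. (\<lambda>t. pdiffs vs F (u(v := t))) differentiable (at (u v))))"

definition total_diff :: "nat \<Rightarrow> (jet \<Rightarrow> real) \<Rightarrow> jet \<Rightarrow> real" where
  "total_diff m F u = pdiff VX F u + (\<Sum>i<m. u (VP (Suc i)) * pdiff (VP i) F u)"

text \<open>\<open>euler_lagrange m n\<close> is \<open>E\<^sub>m\<^sup>n\<close>; the power of \<open>total_diff m\<close> is iterated composition.\<close>

definition euler_lagrange :: "nat \<Rightarrow> nat \<Rightarrow> (jet \<Rightarrow> real) \<Rightarrow> jet \<Rightarrow> real" where
  "euler_lagrange m n F u = (\<Sum>k\<le>n. (-1) ^ k * (total_diff m ^^ k) (pdiff (VP k) F) u)"

text \<open>The interval integrals are oriented: they change sign when the upper limit is negative.\<close>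

definition antideriv :: "nat \<Rightarrow> (jet \<Rightarrow> real) \<Rightarrow> jet \<Rightarrow> real" where
  "antideriv k F u = (LBINT t=0..u (VP k). F (u(VP k := t)))"

definition antideriv2 :: "nat \<Rightarrow> (jet \<Rightarrow> real) \<Rightarrow> jet \<Rightarrow> real" where
  "antideriv2 k F u = (LBINT t=0..u (VP k). (LBINT s=0..t. F (u(VP k := s))))"

definition solution_system ::
    "(jet \<Rightarrow> real) \<Rightarrow> (jet \<Rightarrow> real) \<Rightarrow> (jet \<Rightarrow> real) \<Rightarrow> (jet \<Rightarrow> real) \<Rightarrow>
     (jet \<Rightarrow> real) \<Rightarrow> (jet \<Rightarrow> real) \<Rightarrow> (jet \<Rightarrow> real) \<Rightarrow> bool" where
  "solution_system R2 f0 f1 N1 f3 \<rho>2 L2 \<longleftrightarrow>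
     (\<forall>u. f3 u =
        pdiff (VP 2) R2 u * (u (VP 3))\<^sup>2 + 2 * total_diff 2 R2 u * u (VP 3)
        - exp (R2 u) *
            (euler_lagrange 2 2 (antideriv2 2 (\<lambda>w. exp (- R2 w))) u
             + f1 u * u (VP 2) - euler_lagrange 1 1 (antideriv2 1 f1) u + f0 u)) \<and>
     (\<forall>u. \<rho>2 u = exp (- R2 u)) \<and>
     (\<forall>u. L2 u =
        antideriv2 2 (\<lambda>w. exp (- R2 w)) u - antideriv2 1 f1 u + antideriv 0 f0 u
        + total_diff 2 N1 u)"

end

theory Submission
  imports Defs
begin

text \<open>
  In \<open>E\<^sub>4\<^sup>2 L\<close>, for a Lagrangian \<open>L\<close> of order two, the variables \<open>p\<^sub>3\<close> and \<open>p\<^sub>4\<close> occur only polynomially.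
  Writing \<open>\<rho> = \<partial>\<^sub>2\<^sup>2 L\<close> and expanding \<open>D\<^sub>4 = D\<^sub>2 + p\<^sub>3 \<partial>\<^sub>2 + p\<^sub>4 \<partial>\<^sub>3\<close> gives (\<open>euler_lagrange_order_2\<close>)
  \<open>E\<^sub>4\<^sup>2 L = \<rho> p\<^sub>4 + \<partial>\<^sub>2 \<rho> p\<^sub>3\<^sup>2 + 2 D\<^sub>2 \<rho> p\<^sub>3 + E\<^sub>2\<^sup>2 L\<close>.
  Comparing the coefficients of \<open>p\<^sub>4\<close> in the equation \<open>\<rho>\<^sub>2 (p\<^sub>4 - f\<^sub>3) = E\<^sub>4\<^sup>2 L\<^sub>2\<close> therefore forces
  \<open>\<rho>\<^sub>2 = \<partial>\<^sub>2\<^sup>2 L\<^sub>2\<close>, and positivity allows us to write \<open>\<rho>\<^sub>2 = e\<^bsup>-R\<^sub>2\<^esup>\<close>.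

  The normal form of \<open>L\<^sub>2\<close> holds for every Lagrangian of order two (\<open>lagrangian_normal_form\<close>).
  Up to the double antiderivative of its second derivative, a function of order \<open>k + 1\<close> is affine in
  its top variable, and a linear term \<open>p\<^bsub>k+1\<^esub> A\<close> is a total derivative up to a term of order \<open>k\<close>,
  namely \<open>p\<^bsub>k+1\<^esub> A = D\<^bsub>k+1\<^esub> M - D\<^sub>k M\<close> for the antiderivative \<open>M\<close> of \<open>A\<close> with respect to \<open>p\<^sub>k\<close>. Applying
  this at orders two and one, and integrating what is left at order zero with respect to \<open>p\<^sub>0\<close> and
  \<open>x\<close>, gives \<open>f\<^sub>1\<close>, \<open>f\<^sub>0\<close> and \<open>N\<^sub>1\<close>.

  For a Lagrangian in normal form the Euler--Lagrange expression is explicit: the total derivative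
  contributes nothing, since its expression telescopes (\<open>euler_lagrange_total_diff\<close>), and the other
  three terms are handled by the expansions for orders two, one and zero. The result
  (\<open>euler_lagrange_solution\<close>) is \<open>\<rho>\<^sub>2 (p\<^sub>4 - f\<^sub>3)\<close> with \<open>f\<^sub>3\<close> given by the stated formula. This is the
  converse direction, and, after division by \<open>\<rho>\<^sub>2\<close>, it also yields the formula for \<open>f\<^sub>3\<close> in the
  forward direction.

  The analysis consists of the closure properties of smooth functions, of differentiation under the
  integral sign, and of the symmetry of mixed partial derivatives, which is derived from the latter.
\<close>

section \<open>Smooth functions on the jet space\<close>

definition partially_differentiable :: "(jet \<Rightarrow> real) \<Rightarrow> bool" where
  "partially_differentiable F \<longleftrightarrow>
     continuous_on UNIV F \<and> (\<forall>v u. (\<lambda>t. F (u(v := t))) differentiable (at (u v)))"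

definition smooth :: "(jet \<Rightarrow> real) \<Rightarrow> bool" where
  "smooth F \<longleftrightarrow> (\<forall>vs. partially_differentiable (pdiffs vs F))"

lemma smooth_fun_iff: "smooth_fun k F \<longleftrightarrow> depends_upto k F \<and> smooth F"
  by (auto simp: smooth_fun_def smooth_def partially_differentiable_def)

lemma smooth_imp_partially_differentiable: "smooth F \<Longrightarrow> partially_differentiable F"
  unfolding smooth_def by (metis pdiffs.simps(1))

lemma smooth_pdiff:
  assumes "smooth F"
  shows "smooth (pdiff v F)"
proof -
  have "pdiffs vs (pdiff v F) = pdiffs (vs @ [v]) F" for vs
    by (induction vs) simp_all
  then show ?thesis
    using assms by (simp add: smooth_def)
qed

text \<open>
  Smoothness is the largest class of partially differentiable functions that is closed under partial
  differentiation. A closure property can therefore be proved by exhibiting an invariant class,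
  without an explicit formula for the iterated derivatives.
\<close>

lemma smooth_coinduct:
  assumes "X F"
    and step: "\<And>G. X G \<Longrightarrow> partially_differentiable G \<and> (\<forall>v. X (pdiff v G))"
  shows "smooth F"
proof -
  have "X (pdiffs vs F)" for vs
    by (induction vs) (use assms in auto)
  then show ?thesis
    using step by (auto simp: smooth_def)
qed

lemma partially_differentiable_continuous:
  "partially_differentiable F \<Longrightarrow> continuous_on UNIV F"
  by (simp add: partially_differentiable_def)

lemma DERIV_pdiff:
  assumes "partially_differentiable F"
  shows "((\<lambda>t. F (u(v := t))) has_field_derivative pdiff v F (u(v := x))) (at x)"
proof -
  have "(\<lambda>t. F ((u(v := x))(v := t))) differentiable (at ((u(v := x)) v))"
    using assms unfolding partially_differentiable_def by blast
  then have "(\<lambda>t. F (u(v := t))) differentiable (at x)"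
    by simp
  then have "((\<lambda>t. F (u(v := t))) has_field_derivative deriv (\<lambda>t. F (u(v := t))) x) (at x)"
    by (simp add: DERIV_deriv_iff_real_differentiable)
  then show ?thesis
    by (simp add: pdiff_def)
qed

lemma DERIV_pdiff_at:
  assumes "partially_differentiable F"
  shows "((\<lambda>t. F (u(v := t))) has_field_derivative pdiff v F u) (at (u v))"
  using DERIV_pdiff[OF assms, of u v "u v"] by simp

lemma pdiff_eqI:
  assumes "\<And>u. ((\<lambda>t. F (u(v := t))) has_field_derivative G u) (at (u v))"
  shows "pdiff v F = G"
  using assms by (auto simp: pdiff_def fun_eq_iff intro: DERIV_imp_deriv)

lemma partially_differentiableI:
  assumes "continuous_on UNIV F"
    and "\<And>v u. ((\<lambda>t. F (u(v := t))) has_field_derivative G v u) (at (u v))"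
  shows "partially_differentiable F" "pdiff v F = G v"
proof -
  show "partially_differentiable F"
    using assms by (auto simp: partially_differentiable_def real_differentiable_def)
  show "pdiff v F = G v"
    using assms(2) by (rule pdiff_eqI)
qed

lemma continuous_on_fun_upd:
  fixes f :: "'a::topological_space \<Rightarrow> jet"
  assumes "continuous_on S f" "continuous_on S g"
  shows "continuous_on S (\<lambda>x. (f x)(v := g x))"
proof (rule continuous_on_coordinatewise_then_product)
  fix i
  show "continuous_on S (\<lambda>x. ((f x)(v := g x)) i)"
    using assms by (cases "i = v") (auto intro: continuous_on_product_then_coordinatewise)
qed

lemma continuous_on_jet_compose:
  fixes F :: "jet \<Rightarrow> real"
  assumes "continuous_on UNIV F" "continuous_on S f"
  shows "continuous_on S (\<lambda>x. F (f x))"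
  using continuous_on_compose2[OF assms] by simp

lemma continuous_on_freeze:
  fixes F :: "jet \<Rightarrow> real"
  assumes "continuous_on UNIV F"
  shows "continuous_on UNIV (\<lambda>u. F (u(v := c)))"
  by (rule continuous_on_jet_compose[OF assms] continuous_on_fun_upd continuous_on_id continuous_on_const)+


subsection \<open>Antiderivatives in one variable\<close>

text \<open>
  The base variable \<open>x\<close> is included because the part of a Lagrangian that depends on \<open>x\<close> alone has
  to be written as a total derivative.
\<close>

definition primitive_in :: "jet_var \<Rightarrow> (jet \<Rightarrow> real) \<Rightarrow> jet \<Rightarrow> real" where
  "primitive_in v F u = (LBINT t=0..u v. F (u(v := t)))"

lemma antideriv_eq: "antideriv k F = primitive_in (VP k) F"
  by (simp add: fun_eq_iff antideriv_def primitive_in_def)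

lemma antideriv2_eq: "antideriv2 k F = primitive_in (VP k) (primitive_in (VP k) F)"
  by (simp add: fun_eq_iff antideriv2_def primitive_in_def)

lemma primitive_in_at_zero: "primitive_in v F (u(v := 0)) = 0"
  by (simp add: primitive_in_def flip: zero_ereal_def)

lemma DERIV_primitive_in:
  assumes "continuous_on UNIV F"
  shows "((\<lambda>t. primitive_in v F (u(v := t))) has_field_derivative F (u(v := x))) (at x)"
proof -
  let ?f = "\<lambda>t. F (u(v := t))"
  let ?a = "min 0 x - 1" and ?b = "max 0 x + 1"
  have "continuous_on {?a..?b} ?f"
    by (intro continuous_on_jet_compose[OF assms] continuous_on_fun_upd continuous_intros)
  then have "((\<lambda>t. LBINT y=ereal 0..ereal t. ?f y) has_vector_derivative ?f x) (at x within {?a..?b})"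
    by (intro interval_integral_FTC2) auto
  moreover have "at x within {?a..?b} = at x"
    by (intro at_within_interior) (auto simp: interior_atLeastAtMost_real)
  ultimately show ?thesis
    by (simp add: primitive_in_def has_real_derivative_iff_has_vector_derivative zero_ereal_def)
qed

text \<open>
  After rescaling, the domain of integration is the fixed interval \<open>[0, 1]\<close>, so that the theorems on
  integrals with parameters apply.
\<close>

lemma primitive_in_eq_integral:
  assumes "continuous_on UNIV F"
  shows "primitive_in v F u = u v * integral (cbox 0 1) (\<lambda>s. F (u(v := s * u v)))"
proof -
  have "((\<lambda>s. primitive_in v F (u(v := s * u v))) has_field_derivative
          F (u(v := s * u v)) * u v) (at s within {0..1})" for s
    by (rule DERIV_chain2[OF DERIV_primitive_in[OF assms]]) (auto intro!: derivative_eq_intros)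
  then have "((\<lambda>s. F (u(v := s * u v)) * u v) has_integral
      (primitive_in v F (u(v := 1 * u v)) - primitive_in v F (u(v := 0 * u v)))) {0..1}"
    by (intro fundamental_theorem_of_calculus zero_le_one)
       (simp only: flip: has_real_derivative_iff_has_vector_derivative)
  then have "((\<lambda>s. F (u(v := s * u v)) * u v) has_integral primitive_in v F u) {0..1}"
    by (simp add: primitive_in_at_zero)
  then show ?thesis
    by (simp add: integral_unique mult.commute flip: integral_mult_right)
qed

lemma continuous_on_primitive_in:
  assumes "continuous_on UNIV F"
  shows "continuous_on UNIV (primitive_in v F)"
proof -
  have "continuous_on (UNIV \<times> cbox 0 1) (\<lambda>p. F ((fst p)(v := snd p * fst p v)))"
    by (intro continuous_on_jet_compose[OF assms] continuous_on_fun_upd continuous_intros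
        continuous_on_product_then_coordinatewise[where f = fst])
  then have "continuous_on UNIV (\<lambda>u. integral (cbox 0 1) (\<lambda>s. F (u(v := s * u v))))"
    by (intro integral_continuous_on_param) (simp add: split_def)
  then show ?thesis
    by (simp add: primitive_in_eq_integral[OF assms, abs_def] continuous_on_mult)
qed

lemma DERIV_primitive_in_other:
  assumes F: "partially_differentiable F" and F': "continuous_on UNIV (pdiff w F)" and "w \<noteq> v"
  shows "((\<lambda>t. primitive_in v F (u(w := t))) has_field_derivative primitive_in v (pdiff w F) u) (at (u w))"
proof -
  let ?u = "\<lambda>x s. u(v := s * u v, w := x)"
  have cF: "continuous_on UNIV F"
    using F by (rule partially_differentiable_continuous)
  have "((\<lambda>x. integral (cbox 0 1) (\<lambda>s. F (?u x s))) has_field_derivative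
          integral (cbox 0 1) (\<lambda>s. pdiff w F (?u (u w) s))) (at (u w) within UNIV)"
  proof (rule leibniz_rule_field_derivative)
    show "((\<lambda>x. F (?u x s)) has_field_derivative pdiff w F (?u x s)) (at x within UNIV)" for x s
      by (rule DERIV_pdiff[OF F])
    show "(\<lambda>s. F (?u x s)) integrable_on cbox 0 1" for x
      by (intro integrable_continuous continuous_on_jet_compose[OF cF] continuous_on_fun_upd
          continuous_intros)
    show "continuous_on (UNIV \<times> cbox 0 1) (\<lambda>(x, s). pdiff w F (?u x s))"
      unfolding split_def
      by (intro continuous_on_jet_compose[OF F'] continuous_on_fun_upd continuous_intros)
  qed auto
  then have "((\<lambda>x. u v * integral (cbox 0 1) (\<lambda>s. F (?u x s))) has_field_derivative
          u v * integral (cbox 0 1) (\<lambda>s. pdiff w F (?u (u w) s))) (at (u w))"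
    by (rule DERIV_cmult)
  moreover have "?u x s = (u(w := x))(v := s * u v)" "?u (u w) s = u(v := s * u v)" for x s
    using \<open>w \<noteq> v\<close> by (auto simp: fun_upd_twist)
  ultimately show ?thesis
    using \<open>w \<noteq> v\<close> by (simp add: primitive_in_eq_integral[OF cF] primitive_in_eq_integral[OF F'])
qed

lemma partially_differentiable_primitive_in:
  assumes F: "partially_differentiable F" and F': "\<And>w. continuous_on UNIV (pdiff w F)"
  shows "partially_differentiable (primitive_in v F)"
    and "pdiff w (primitive_in v F) = (if w = v then F else primitive_in v (pdiff w F))"
proof -
  note cF = partially_differentiable_continuous[OF F]
  have *: "((\<lambda>t. primitive_in v F (u(w := t))) has_field_derivative
        (if w = v then F else primitive_in v (pdiff w F)) u) (at (u w))" for u w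
    using DERIV_primitive_in[OF cF, of v u "u v"] DERIV_primitive_in_other[OF F F', of w v u]
    by simp
  show "partially_differentiable (primitive_in v F)"
    and "pdiff w (primitive_in v F) = (if w = v then F else primitive_in v (pdiff w F))"
    using partially_differentiableI[OF continuous_on_primitive_in[OF cF] *] by auto
qed


subsection \<open>Closure properties\<close>

text \<open>
  The closure of the smooth functions under all operations of interest at once. The chain and product
  rules mix these operations, so a class built from one of them is in general not invariant under
  partial differentiation, whereas the joint closure is.
\<close>

inductive jet_expression :: "(jet \<Rightarrow> real) \<Rightarrow> bool" where
  base: "smooth F \<Longrightarrow> jet_expression F"
| const: "jet_expression (\<lambda>u. c)"
| coord: "jet_expression (\<lambda>u. u v)"
| add: "jet_expression F \<Longrightarrow> jet_expression G \<Longrightarrow> jet_expression (\<lambda>u. F u + G u)"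
| mult: "jet_expression F \<Longrightarrow> jet_expression G \<Longrightarrow> jet_expression (\<lambda>u. F u * G u)"
| exp: "jet_expression F \<Longrightarrow> jet_expression (\<lambda>u. exp (F u))"
| ln: "jet_expression F \<Longrightarrow> (\<And>u. F u > 0) \<Longrightarrow> jet_expression (\<lambda>u. ln (F u))"
| freeze: "jet_expression F \<Longrightarrow> jet_expression (\<lambda>u. F (u(v := c)))"
| primitive_in: "jet_expression F \<Longrightarrow> jet_expression (primitive_in v F)"

lemma
  shows partially_differentiable_const: "partially_differentiable (\<lambda>u. c)"
    and pdiff_const: "pdiff v (\<lambda>u. c) = (\<lambda>u. 0)"
  by (rule partially_differentiableI[where G = "\<lambda>_ _. 0"]; simp)+

lemma
  shows partially_differentiable_coord: "partially_differentiable (\<lambda>u. u v)"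
    and pdiff_coord: "pdiff w (\<lambda>u. u v) = (\<lambda>u. if w = v then 1 else 0)"
proof -
  have "((\<lambda>t. (u(w := t)) v) has_field_derivative (if w = v then 1 else 0)) (at (u w))" for u w
    by (auto intro!: derivative_eq_intros)
  from partially_differentiableI[OF _ this]
  show "partially_differentiable (\<lambda>u. u v)" "pdiff w (\<lambda>u. u v) = (\<lambda>u. if w = v then 1 else 0)"
    by auto
qed

lemma
  assumes "partially_differentiable F" "partially_differentiable G"
  shows partially_differentiable_add: "partially_differentiable (\<lambda>u. F u + G u)"
    and pdiff_add': "pdiff w (\<lambda>u. F u + G u) = (\<lambda>u. pdiff w F u + pdiff w G u)"
proof -
  have "((\<lambda>t. F (u(w := t)) + G (u(w := t))) has_field_derivative (pdiff w F u + pdiff w G u)) (at (u w))"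
    for u w
    using assms by (auto intro!: derivative_eq_intros DERIV_pdiff_at)
  from partially_differentiableI[OF _ this]
  show "partially_differentiable (\<lambda>u. F u + G u)" "pdiff w (\<lambda>u. F u + G u) = (\<lambda>u. pdiff w F u + pdiff w G u)"
    using assms by (auto intro: continuous_on_add partially_differentiable_continuous)
qed

lemma
  assumes "partially_differentiable F" "partially_differentiable G"
  shows partially_differentiable_mult: "partially_differentiable (\<lambda>u. F u * G u)"
    and pdiff_mult': "pdiff w (\<lambda>u. F u * G u) = (\<lambda>u. pdiff w F u * G u + F u * pdiff w G u)"
proof -
  have "((\<lambda>t. F (u(w := t)) * G (u(w := t))) has_field_derivative
      (pdiff w F u * G u + F u * pdiff w G u)) (at (u w))" for u w
    using DERIV_mult[OF DERIV_pdiff_at[OF assms(1), of u w] DERIV_pdiff_at[OF assms(2), of u w]]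
    by (simp add: algebra_simps)
  from partially_differentiableI[OF _ this]
  show "partially_differentiable (\<lambda>u. F u * G u)"
    "pdiff w (\<lambda>u. F u * G u) = (\<lambda>u. pdiff w F u * G u + F u * pdiff w G u)"
    using assms by (auto intro: continuous_on_mult partially_differentiable_continuous)
qed

lemma
  assumes "partially_differentiable F"
  shows partially_differentiable_exp: "partially_differentiable (\<lambda>u. exp (F u))"
    and pdiff_exp': "pdiff w (\<lambda>u. exp (F u)) = (\<lambda>u. exp (F u) * pdiff w F u)"
proof -
  have "((\<lambda>t. exp (F (u(w := t)))) has_field_derivative exp (F u) * pdiff w F u) (at (u w))" for u w
    using DERIV_chain2[OF DERIV_exp DERIV_pdiff_at[OF assms], of u w] by simp
  from partially_differentiableI[OF _ this]
  show "partially_differentiable (\<lambda>u. exp (F u))"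
    "pdiff w (\<lambda>u. exp (F u)) = (\<lambda>u. exp (F u) * pdiff w F u)"
    using assms by (auto intro: continuous_on_exp partially_differentiable_continuous)
qed

text \<open>
  The reciprocal of \<open>F\<close> is expressed by \<open>exp\<close> and \<open>ln\<close>, so that the derivative is again an expression
  in the sense of \<open>jet_expression\<close>.
\<close>

lemma
  assumes "partially_differentiable F" and pos: "\<And>u. F u > 0"
  shows partially_differentiable_ln: "partially_differentiable (\<lambda>u. ln (F u))"
    and pdiff_ln': "pdiff w (\<lambda>u. ln (F u)) = (\<lambda>u. exp (- 1 * ln (F u)) * pdiff w F u)"
proof -
  have cont: "continuous_on UNIV (\<lambda>u. ln (F u))"
    using assms(1) pos
    by (intro continuous_on_ln partially_differentiable_continuous) (auto simp: less_le)
  have deriv: "((\<lambda>t. ln (F (u(w := t)))) has_field_derivative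
      exp (- 1 * ln (F u)) * pdiff w F u) (at (u w))" for u w
    using DERIV_chain2[OF DERIV_ln DERIV_pdiff_at[OF assms(1)], of u w] pos[of u]
    by (simp add: exp_minus)
  show "partially_differentiable (\<lambda>u. ln (F u))"
    by (rule partially_differentiableI(1)[OF cont deriv])
  show "pdiff w (\<lambda>u. ln (F u)) = (\<lambda>u. exp (- 1 * ln (F u)) * pdiff w F u)"
    by (rule partially_differentiableI(2)[OF cont deriv])
qed

lemma
  assumes "partially_differentiable F"
  shows partially_differentiable_freeze: "partially_differentiable (\<lambda>u. F (u(v := c)))"
    and pdiff_freeze': "pdiff w (\<lambda>u. F (u(v := c))) = (if w = v then (\<lambda>u. 0) else (\<lambda>u. pdiff w F (u(v := c))))"
proof -
  have cont: "continuous_on UNIV (\<lambda>u. F (u(v := c)))"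
    by (rule continuous_on_freeze[OF partially_differentiable_continuous[OF assms]])
  have deriv: "((\<lambda>t. F ((u(w := t))(v := c))) has_field_derivative
      (if w = v then (\<lambda>u. 0) else (\<lambda>u. pdiff w F (u(v := c)))) u) (at (u w))" for u w
    using DERIV_pdiff_at[OF assms, of "u(v := c)" w] by (cases "w = v") (auto simp: fun_upd_twist)
  show "partially_differentiable (\<lambda>u. F (u(v := c)))"
    by (rule partially_differentiableI(1)[OF cont deriv])
  show "pdiff w (\<lambda>u. F (u(v := c))) = (if w = v then (\<lambda>u. 0) else (\<lambda>u. pdiff w F (u(v := c))))"
    by (rule partially_differentiableI(2)[OF cont deriv])
qed

lemmas partially_differentiable_closure =
  partially_differentiable_const partially_differentiable_coord partially_differentiable_add
  partially_differentiable_mult partially_differentiable_exp partially_differentiable_ln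
  partially_differentiable_freeze partially_differentiable_primitive_in

text \<open>
  Continuity of the derivatives is carried along in the induction because differentiation under the
  integral sign requires it.
\<close>

lemma jet_expression_step:
  assumes "jet_expression F"
  shows "partially_differentiable F \<and> (\<forall>v. jet_expression (pdiff v F) \<and> continuous_on UNIV (pdiff v F))"
  using assms
proof induction
  case (base F)
  then show ?case
    by (auto intro: jet_expression.base smooth_pdiff smooth_imp_partially_differentiable
        partially_differentiable_continuous)
next
  case (mult F G)
  then show ?case
    by (auto simp: pdiff_mult' intro!: partially_differentiable_mult jet_expression.intros(2-9)
       continuous_intros intro: partially_differentiable_continuous)
next
  case (ln F)
  then have F: "partially_differentiable F" by simp
  have "jet_expression (pdiff v (\<lambda>u. ln (F u)))" for v
    unfolding pdiff_ln'[OF F ln.hyps(2)]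
    by (intro jet_expression.intros(2-9)) (use ln in auto)
  moreover have "continuous_on UNIV (pdiff v (\<lambda>u. ln (F u)))" for v
    unfolding pdiff_ln'[OF F ln.hyps(2)]
    by (intro continuous_intros partially_differentiable_continuous[OF F])
       (use ln in \<open>auto simp: less_le\<close>)
  ultimately show ?case
    using partially_differentiable_ln[OF F ln.hyps(2)] by simp
next
  case (freeze F v c)
  then show ?case
    by (auto simp: pdiff_freeze' intro!: partially_differentiable_freeze jet_expression.intros(2-9)
       continuous_on_freeze)
next
  case (primitive_in F v)
  then show ?case
    by (auto simp: partially_differentiable_primitive_in intro: jet_expression.intros(2-9)
       continuous_on_primitive_in partially_differentiable_continuous)
qed (auto simp: pdiff_const pdiff_coord pdiff_add' pdiff_exp' intro: jet_expression.intros(2-9)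
     partially_differentiable_continuous intro!: partially_differentiable_closure continuous_intros)

lemma jet_expression_iff_smooth: "jet_expression F \<longleftrightarrow> smooth F"
  using smooth_coinduct[of jet_expression F] jet_expression_step jet_expression.base by blast

lemmas smooth_intros =
  jet_expression.intros(2-9)[unfolded jet_expression_iff_smooth] smooth_pdiff

lemmas pdiff_add = pdiff_add'[OF smooth_imp_partially_differentiable smooth_imp_partially_differentiable]
lemmas pdiff_mult = pdiff_mult'[OF smooth_imp_partially_differentiable smooth_imp_partially_differentiable]
lemmas pdiff_exp = pdiff_exp'[OF smooth_imp_partially_differentiable]
lemmas pdiff_freeze = pdiff_freeze'[OF smooth_imp_partially_differentiable]

lemma smooth_continuous: "smooth F \<Longrightarrow> continuous_on UNIV F"
  by (simp add: smooth_imp_partially_differentiable partially_differentiable_continuous)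

lemma pdiff_primitive_in:
  "smooth F \<Longrightarrow> pdiff w (primitive_in v F) = (if w = v then F else primitive_in v (pdiff w F))"
  by (intro partially_differentiable_primitive_in smooth_imp_partially_differentiable
      smooth_continuous smooth_pdiff)

lemma smooth_uminus:
  assumes "smooth F"
  shows "smooth (\<lambda>u. - F u)"
  using smooth_intros(4)[OF smooth_intros(1)[of "-1"] assms] by simp

lemma smooth_diff:
  assumes "smooth F" "smooth G"
  shows "smooth (\<lambda>u. F u - G u)"
  using smooth_intros(3)[OF assms(1) smooth_uminus[OF assms(2)]] by simp

lemma smooth_power:
  assumes "smooth F"
  shows "smooth (\<lambda>u. F u ^ n)"
  by (induction n) (auto intro: smooth_intros assms)

lemma smooth_sum: "(\<And>i. i \<in> I \<Longrightarrow> smooth (F i)) \<Longrightarrow> smooth (\<lambda>u. \<Sum>i\<in>I. F i u)"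
  by (induction I rule: infinite_finite_induct) (auto intro: smooth_intros)

lemma pdiff_uminus: "smooth F \<Longrightarrow> pdiff w (\<lambda>u. - F u) = (\<lambda>u. - pdiff w F u)"
  using pdiff_mult[OF smooth_intros(1)[of "-1"], of F w] by (simp add: pdiff_const)

lemma pdiff_diff:
  "smooth F \<Longrightarrow> smooth G \<Longrightarrow> pdiff w (\<lambda>u. F u - G u) = (\<lambda>u. pdiff w F u - pdiff w G u)"
  using pdiff_add[OF _ smooth_uminus, of F G w] by (simp add: pdiff_uminus)

lemma pdiff_sum:
  assumes "\<And>i. i \<in> I \<Longrightarrow> smooth (F i)"
  shows "pdiff w (\<lambda>u. \<Sum>i\<in>I. F i u) = (\<lambda>u. \<Sum>i\<in>I. pdiff w (F i) u)"
  using assms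
  by (induction I rule: infinite_finite_induct) (auto simp: pdiff_const pdiff_add smooth_sum)

text \<open>
  Kept apart from the automatic rules below, because its conclusion is not a higher-order pattern and
  unifies with too many goals.
\<close>

lemmas smooth_freeze = smooth_intros(7)

lemmas smooth_rules [simp, intro] = smooth_intros(1-6,8,9) smooth_uminus smooth_diff smooth_power smooth_sum

lemmas pdiff_rules =
  pdiff_const pdiff_coord pdiff_add pdiff_mult pdiff_exp pdiff_uminus pdiff_diff

lemma primitive_in_pdiff:
  assumes "smooth F"
  shows "primitive_in v (pdiff v F) u = F u - F (u(v := 0))"
proof -
  let ?H = "\<lambda>t. F (u(v := t)) - primitive_in v (pdiff v F) (u(v := t))"
  have "(?H has_field_derivative 0) (at t)" for t
    by (rule derivative_eq_intros DERIV_pdiff[OF smooth_imp_partially_differentiable]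
        DERIV_primitive_in smooth_continuous smooth_pdiff assms | simp)+
  then have "?H (u v) = ?H 0"
    by (intro DERIV_isconst_all allI)
  then show ?thesis
    by (simp add: primitive_in_at_zero)
qed

lemma primitive_in_independent:
  assumes "\<And>u t. F (u(v := t)) = F u"
  shows "primitive_in v F u = u v * F u"
  using assms by (simp add: primitive_in_def zero_ereal_def)

text \<open>
  Schwarz's theorem follows from differentiation under the integral sign: writing \<open>F\<close> as the
  antiderivative in \<open>w\<close> of its \<open>w\<close>-derivative plus its restriction to \<open>w = 0\<close>, the operator \<open>pdiff v\<close>
  passes inside the integral, and \<open>pdiff w\<close> then undoes the integral.
\<close>

lemma pdiff_commute:
  assumes "smooth F"
  shows "pdiff v (pdiff w F) = pdiff w (pdiff v F)"
proof (cases "v = w")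
  case False
  have "F = (\<lambda>u. primitive_in w (pdiff w F) u + F (u(w := 0)))"
    using assms by (simp add: primitive_in_pdiff)
  then have "pdiff v F = pdiff v (\<lambda>u. primitive_in w (pdiff w F) u + F (u(w := 0)))"
    by simp
  also have "\<dots> = (\<lambda>u. primitive_in w (pdiff v (pdiff w F)) u + pdiff v F (u(w := 0)))"
    using assms False by (simp add: pdiff_add pdiff_primitive_in pdiff_freeze smooth_freeze)
  finally have "pdiff w (pdiff v F) =
      pdiff w (\<lambda>u. primitive_in w (pdiff v (pdiff w F)) u + pdiff v F (u(w := 0)))"
    by simp
  also have "\<dots> = pdiff v (pdiff w F)"
    using assms by (simp add: pdiff_add pdiff_primitive_in pdiff_freeze smooth_freeze)
  finally show ?thesis ..
qed simp

section \<open>Order of a function\<close>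

lemma depends_uptoI:
  "(\<And>u w. u VX = w VX \<Longrightarrow> (\<And>i. i \<le> k \<Longrightarrow> u (VP i) = w (VP i)) \<Longrightarrow> F u = F w) \<Longrightarrow> depends_upto k F"
  unfolding depends_upto_def by blast

lemma depends_uptoD:
  "depends_upto k F \<Longrightarrow> u VX = w VX \<Longrightarrow> (\<And>i. i \<le> k \<Longrightarrow> u (VP i) = w (VP i)) \<Longrightarrow> F u = F w"
  unfolding depends_upto_def by blast

lemma depends_upto_mono:
  assumes "depends_upto k F" "k \<le> l"
  shows "depends_upto l F"
  by (intro depends_uptoI depends_uptoD[OF assms(1)]) (use assms(2) in auto)

lemma depends_upto_const: "depends_upto k (\<lambda>u. c)"
  and depends_upto_VP: "i \<le> k \<Longrightarrow> depends_upto k (\<lambda>u. u (VP i))"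
  by (simp_all add: depends_upto_def)

lemma depends_upto_comp2:
  assumes "depends_upto k F" "depends_upto k G"
  shows "depends_upto k (\<lambda>u. g (F u) (G u))"
proof (rule depends_uptoI)
  fix u w :: jet
  assume *: "u VX = w VX" "\<And>i. i \<le> k \<Longrightarrow> u (VP i) = w (VP i)"
  show "g (F u) (G u) = g (F w) (G w)"
    using depends_uptoD[OF assms(1) *] depends_uptoD[OF assms(2) *] by (rule arg_cong2)
qed

lemma depends_upto_comp: "depends_upto k F \<Longrightarrow> depends_upto k (\<lambda>u. g (F u))"
  using depends_upto_comp2[where g = "\<lambda>x y. g x"] .

lemma depends_upto_sum:
  assumes "\<And>i. i \<in> I \<Longrightarrow> depends_upto k (F i)"
  shows "depends_upto k (\<lambda>u. \<Sum>i\<in>I. F i u)"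
proof (rule depends_uptoI)
  fix u w :: jet
  assume *: "u VX = w VX" "\<And>i. i \<le> k \<Longrightarrow> u (VP i) = w (VP i)"
  show "(\<Sum>i\<in>I. F i u) = (\<Sum>i\<in>I. F i w)"
    by (intro sum.cong refl depends_uptoD[OF assms *])
qed

lemma depends_upto_freeze_top:
  assumes "depends_upto (Suc k) F"
  shows "depends_upto k (\<lambda>u. F (u(VP (Suc k) := c)))"
proof (rule depends_uptoI)
  fix u w :: jet
  assume VX: "u VX = w VX" and VP: "\<And>i. i \<le> k \<Longrightarrow> u (VP i) = w (VP i)"
  show "F (u(VP (Suc k) := c)) = F (w(VP (Suc k) := c))"
  proof (rule depends_uptoD[OF assms])
    show "(u(VP (Suc k) := c)) VX = (w(VP (Suc k) := c)) VX"
      using VX by simp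
    show "(u(VP (Suc k) := c)) (VP i) = (w(VP (Suc k) := c)) (VP i)" if "i \<le> Suc k" for i
      using VP[of i] that by (cases "i = Suc k") auto
  qed
qed

lemma depends_upto_primitive_in:
  assumes "depends_upto k F" "\<And>i. v = VP i \<Longrightarrow> i \<le> k"
  shows "depends_upto k (primitive_in v F)"
proof (rule depends_uptoI)
  fix u w :: jet
  assume *: "u VX = w VX" "\<And>i. i \<le> k \<Longrightarrow> u (VP i) = w (VP i)"
  have "F (u(v := t)) = F (w(v := t))" for t
    using * by (intro depends_uptoD[OF assms(1)]) auto
  moreover have "u v = w v"
    using * assms(2) by (cases v) auto
  ultimately show "primitive_in v F u = primitive_in v F w"
    by (simp add: primitive_in_def)
qed

lemma pdiff_eq_0:
  assumes "depends_upto k F" "k < i"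
  shows "pdiff (VP i) F = (\<lambda>u. 0)"
proof (rule pdiff_eqI)
  fix u
  have "F (u(VP i := t)) = F u" for t
    using assms(2) by (intro depends_uptoD[OF assms(1)]) auto
  then show "((\<lambda>t. F (u(VP i := t))) has_field_derivative 0) (at (u (VP i)))"
    by simp
qed

lemma depends_upto_pdiff:
  assumes "depends_upto k F"
  shows "depends_upto k (pdiff v F)"
proof (cases "\<exists>i. v = VP i \<and> k < i")
  case True
  then show ?thesis
    using pdiff_eq_0[OF assms] by (auto simp: depends_upto_const)
next
  case False
  show ?thesis
  proof (rule depends_uptoI)
    fix u w :: jet
    assume *: "u VX = w VX" "\<And>i. i \<le> k \<Longrightarrow> u (VP i) = w (VP i)"
    have "F (u(v := t)) = F (w(v := t))" for t
      using * by (intro depends_uptoD[OF assms(1)]) auto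
    moreover have "u v = w v"
      using * False by (cases v) auto
    ultimately show "pdiff v F u = pdiff v F w"
      by (simp add: pdiff_def)
  qed
qed

lemma smooth_total_diff [simp, intro]: "smooth F \<Longrightarrow> smooth (total_diff m F)"
  unfolding total_diff_def [abs_def] by auto

lemma smooth_total_diff_power [simp, intro]: "smooth F \<Longrightarrow> smooth ((total_diff m ^^ k) F)"
  by (induction k) auto

lemma smooth_euler_lagrange [simp, intro]: "smooth F \<Longrightarrow> smooth (euler_lagrange m n F)"
  unfolding euler_lagrange_def [abs_def] by auto

lemma depends_upto_total_diff:
  assumes "depends_upto k F" "m \<le> k"
  shows "depends_upto k (total_diff m F)"
  unfolding total_diff_def [abs_def] using assms
  by (intro depends_upto_comp2[where g = "(+)"] depends_upto_comp2[where g = "(*)"]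
      depends_upto_sum depends_upto_pdiff depends_upto_VP) auto

lemma depends_upto_total_diff_power:
  assumes "depends_upto k F" "m \<le> k"
  shows "depends_upto k ((total_diff m ^^ n) F)"
  using assms by (induction n) (auto intro: depends_upto_total_diff)

lemma depends_upto_euler_lagrange:
  assumes "depends_upto k F" "m \<le> k"
  shows "depends_upto k (euler_lagrange m n F)"
  unfolding euler_lagrange_def [abs_def] using assms
  by (intro depends_upto_comp2[where g = "(*)"]
      depends_upto_sum depends_upto_const depends_upto_total_diff_power depends_upto_pdiff)

section \<open>Total derivatives and Euler--Lagrange operators\<close>

lemma total_diff_Suc:
  "total_diff (Suc m) F = (\<lambda>u. total_diff m F u + u (VP (Suc m)) * pdiff (VP m) F u)"
  by (simp add: total_diff_def fun_eq_iff)

lemma total_diff_eq: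
  assumes "depends_upto k F" "k < m"
  shows "total_diff m F = total_diff (Suc k) F"
  using assms(2)
proof (induction m)
  case (Suc m)
  then show ?case
    using pdiff_eq_0[OF assms(1), of m] by (cases "k = m") (auto simp: total_diff_Suc)
qed simp

lemma total_diff_const: "total_diff m (\<lambda>u. c) = (\<lambda>u. 0)"
  by (simp add: total_diff_def pdiff_const fun_eq_iff)

lemma total_diff_coord: "i < m \<Longrightarrow> total_diff m (\<lambda>u. u (VP i)) = (\<lambda>u. u (VP (Suc i)))"
  by (simp add: total_diff_def pdiff_coord fun_eq_iff if_distrib cong: if_cong)

lemma total_diff_add:
  assumes "smooth F" "smooth G"
  shows "total_diff m (\<lambda>u. F u + G u) = (\<lambda>u. total_diff m F u + total_diff m G u)"
  using assms by (simp add: total_diff_def pdiff_add fun_eq_iff sum.distrib algebra_simps)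

lemma total_diff_mult:
  assumes "smooth F" "smooth G"
  shows "total_diff m (\<lambda>u. F u * G u) = (\<lambda>u. total_diff m F u * G u + F u * total_diff m G u)"
  using assms
  by (simp add: total_diff_def pdiff_mult fun_eq_iff sum.distrib algebra_simps sum_distrib_left)

lemma total_diff_uminus:
  assumes "smooth F"
  shows "total_diff m (\<lambda>u. - F u) = (\<lambda>u. - total_diff m F u)"
  using assms by (simp add: total_diff_def pdiff_uminus fun_eq_iff sum_negf)

lemma total_diff_power_add:
  assumes "smooth F" "smooth G"
  shows "(total_diff m ^^ k) (\<lambda>u. F u + G u) = (\<lambda>u. (total_diff m ^^ k) F u + (total_diff m ^^ k) G u)"
  by (induction k) (simp_all add: assms total_diff_add)

lemma total_diff_power_uminus:
  assumes "smooth F"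
  shows "(total_diff m ^^ k) (\<lambda>u. - F u) = (\<lambda>u. - (total_diff m ^^ k) F u)"
  by (induction k) (simp_all add: assms total_diff_uminus)

lemma total_diff_power_zero: "(total_diff m ^^ k) (\<lambda>u. 0) = (\<lambda>u. 0)"
  by (induction k) (simp_all add: total_diff_const)

lemma euler_lagrange_add:
  assumes "smooth F" "smooth G"
  shows "euler_lagrange m n (\<lambda>u. F u + G u) u = euler_lagrange m n F u + euler_lagrange m n G u"
  using assms
  by (simp add: euler_lagrange_def pdiff_add total_diff_power_add sum.distrib algebra_simps)

lemma euler_lagrange_uminus:
  assumes "smooth F"
  shows "euler_lagrange m n (\<lambda>u. - F u) u = - euler_lagrange m n F u"
  using assms
  by (simp add: euler_lagrange_def pdiff_uminus total_diff_power_uminus flip: sum_negf)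

lemma pdiff_total_diff_0:
  assumes "smooth F"
  shows "pdiff (VP 0) (total_diff m F) = total_diff m (pdiff (VP 0) F)"
  using assms unfolding total_diff_def [abs_def]
  by (simp add: pdiff_rules pdiff_sum pdiff_commute[of F "VP 0"])

lemma pdiff_total_diff_Suc:
  assumes "smooth F" "j < m"
  shows "pdiff (VP (Suc j)) (total_diff m F) = (\<lambda>u. total_diff m (pdiff (VP (Suc j)) F) u + pdiff (VP j) F u)"
proof -
  have "(\<Sum>i<m. (if j = i then 1 else 0) * pdiff (VP i) F u) = pdiff (VP j) F u" for u
    using assms(2) by (simp add: if_distrib[of "\<lambda>x. x * _"] cong: if_cong)
  then show ?thesis
    using assms(1) unfolding total_diff_def [abs_def]
    by (simp add: pdiff_rules pdiff_sum pdiff_commute[of F "VP (Suc j)"] sum.distrib add_ac)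
qed

text \<open>
  By the commutation relations above, the summand for \<open>k = n + 1\<close> contains the negative of the partial
  sum up to \<open>n\<close>, so only the top term of each partial sum survives.
\<close>

lemma euler_lagrange_total_diff_partial:
  assumes "smooth F" "n \<le> m"
  shows "euler_lagrange m n (total_diff m F) u = (- 1) ^ n * (total_diff m ^^ Suc n) (pdiff (VP n) F) u"
  using assms(2)
proof (induction n)
  case 0
  then show ?case
    using assms(1) by (simp add: euler_lagrange_def pdiff_total_diff_0)
next
  case (Suc n)
  have "euler_lagrange m (Suc n) (total_diff m F) u = euler_lagrange m n (total_diff m F) u
      + (- 1) ^ Suc n * (total_diff m ^^ Suc n) (pdiff (VP (Suc n)) (total_diff m F)) u"
    by (simp add: euler_lagrange_def)
  also have "(total_diff m ^^ Suc n) (pdiff (VP (Suc n)) (total_diff m F)) u =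
      (total_diff m ^^ Suc n) (total_diff m (pdiff (VP (Suc n)) F)) u + (total_diff m ^^ Suc n) (pdiff (VP n) F) u"
    using Suc.prems assms(1) by (simp add: pdiff_total_diff_Suc total_diff_power_add del: funpow.simps)
  finally show ?case
    using Suc.IH Suc.prems by (simp add: algebra_simps funpow_swap1)
qed

lemma euler_lagrange_total_diff:
  assumes "smooth F" "depends_upto k F" "k < n" "n \<le> m"
  shows "euler_lagrange m n (total_diff m F) u = 0"
  using euler_lagrange_total_diff_partial[OF assms(1,4), of u] pdiff_eq_0[OF assms(2,3)]
  by (simp add: total_diff_power_zero del: funpow.simps)

section \<open>The Euler--Lagrange expression of a solution\<close>

lemma euler_lagrange_1:
  "euler_lagrange m 1 F u = pdiff (VP 0) F u - total_diff m (pdiff (VP 1) F) u"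
  by (simp add: euler_lagrange_def)

lemma euler_lagrange_2:
  "euler_lagrange m 2 F u = pdiff (VP 0) F u - total_diff m (pdiff (VP 1) F) u
      + total_diff m (total_diff m (pdiff (VP 2) F)) u"
  by (simp add: euler_lagrange_def numeral_2_eq_2)

text \<open>
  All truncations beyond the order of \<open>F\<close> agree; this makes the highest jet variable explicit.
\<close>

lemma total_diff_above_order:
  assumes "depends_upto k F" "k < m"
  shows "total_diff m F = (\<lambda>u. total_diff k F u + u (VP (Suc k)) * pdiff (VP k) F u)"
  using total_diff_eq[OF assms] by (simp add: total_diff_Suc)

text \<open>
  One factor \<open>D\<^sub>2 \<rho> p\<^sub>3\<close> comes from differentiating the coefficient \<open>\<rho>\<close> of \<open>p\<^sub>3\<close> in \<open>D\<^sub>4 (\<partial>\<^sub>2 L)\<close>, the other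
  from \<open>\<partial>\<^sub>2 (D\<^sub>2 (\<partial>\<^sub>2 L)) = D\<^sub>2 \<rho> + \<partial>\<^sub>1 (\<partial>\<^sub>2 L)\<close>; the last summand cancels against the \<open>p\<^sub>3\<close>-term of
  \<open>D\<^sub>4 (\<partial>\<^sub>1 L)\<close>.
\<close>

lemma euler_lagrange_order_2:
  assumes L: "smooth L" "depends_upto 2 L"
  defines "\<rho> \<equiv> pdiff (VP 2) (pdiff (VP 2) L)"
  shows "euler_lagrange 4 2 L u = \<rho> u * u (VP 4) + pdiff (VP 2) \<rho> u * (u (VP 3))\<^sup>2
      + 2 * total_diff 2 \<rho> u * u (VP 3) + euler_lagrange 2 2 L u"
proof -
  define G where "G = pdiff (VP 2) L"
  have G: "smooth G" "depends_upto 2 G"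
    using L by (auto simp: G_def intro: depends_upto_pdiff)
  have D4: "total_diff 4 H = (\<lambda>u. total_diff 2 H u + u (VP 3) * pdiff (VP 2) H u)"
    if "depends_upto 2 H" for H
    using total_diff_above_order[OF that, of 4] by simp
  have "pdiff (VP 2) (total_diff 2 G) = (\<lambda>u. total_diff 2 \<rho> u + pdiff (VP 1) G u)"
    using pdiff_total_diff_Suc[OF G(1), of 1 2] by (simp add: \<rho>_def G_def numeral_2_eq_2)
  moreover have "total_diff 4 (\<lambda>u. u (VP 3)) = (\<lambda>u. u (VP 4))"
    using total_diff_coord[of 3 4] by simp
  ultimately have "total_diff 4 (total_diff 4 G) = (\<lambda>u. total_diff 2 (total_diff 2 G) u
      + u (VP 3) * (total_diff 2 \<rho> u + pdiff (VP 1) G u)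
      + (u (VP 4) * \<rho> u + u (VP 3) * (total_diff 2 \<rho> u + u (VP 3) * pdiff (VP 2) \<rho> u)))"
    using G by (simp add: D4 total_diff_add total_diff_mult depends_upto_total_diff
        depends_upto_pdiff \<rho>_def flip: G_def)
  moreover have "total_diff 4 (pdiff (VP 1) L) =
      (\<lambda>u. total_diff 2 (pdiff (VP 1) L) u + u (VP 3) * pdiff (VP 1) G u)"
    using L by (simp add: D4 depends_upto_pdiff G_def pdiff_commute[of L "VP 2"])
  ultimately show ?thesis
    by (simp add: euler_lagrange_2 algebra_simps power2_eq_square flip: G_def)
qed

lemma euler_lagrange_order_1:
  assumes L: "depends_upto 1 L"
  shows "euler_lagrange 4 2 L u = euler_lagrange 1 1 L u - pdiff (VP 1) (pdiff (VP 1) L) u * u (VP 2)"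
proof -
  have "total_diff 4 (pdiff (VP 1) L) =
      (\<lambda>u. total_diff 1 (pdiff (VP 1) L) u + u (VP 2) * pdiff (VP 1) (pdiff (VP 1) L) u)"
    using total_diff_above_order[OF depends_upto_pdiff[OF L], of 4 "VP 1"] by (simp add: numeral_2_eq_2)
  moreover have "pdiff (VP 2) L = (\<lambda>u. 0)"
    using L by (intro pdiff_eq_0[of 1]) auto
  ultimately show ?thesis
    by (simp only: euler_lagrange_1 euler_lagrange_2 total_diff_const) (simp add: algebra_simps)
qed

lemma euler_lagrange_order_0:
  assumes L: "depends_upto 0 L"
  shows "euler_lagrange 4 2 L u = pdiff (VP 0) L u"
  using pdiff_eq_0[OF L, of 1] pdiff_eq_0[OF L, of 2]
  by (simp add: euler_lagrange_2 total_diff_const)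

lemma depends_upto_antiderivatives:
  assumes "depends_upto k F"
  shows "depends_upto k (primitive_in (VP k) F)"
    and "depends_upto k (primitive_in (VP k) (primitive_in (VP k) F))"
proof -
  show *: "depends_upto k (primitive_in (VP k) F)"
    using assms by (rule depends_upto_primitive_in) simp
  show "depends_upto k (primitive_in (VP k) (primitive_in (VP k) F))"
    using * by (rule depends_upto_primitive_in) simp
qed

text \<open>
  The expansion of order two is applied to the double antiderivative of \<open>e\<^bsup>-R\<^sub>2\<^esup>\<close>, where \<open>\<rho> = e\<^bsup>-R\<^sub>2\<^esup>\<close>
  turns derivatives of \<open>\<rho>\<close> into \<open>- \<rho>\<close> times derivatives of \<open>R\<^sub>2\<close>; the expansions of order one and zero
  produce the terms in \<open>f\<^sub>1\<close> and \<open>f\<^sub>0\<close>.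
\<close>

lemma euler_lagrange_solution:
  assumes R2: "smooth R2" "depends_upto 2 R2"
    and f0: "smooth f0" "depends_upto 0 f0"
    and f1: "smooth f1" "depends_upto 1 f1"
    and N1: "smooth N1" "depends_upto 1 N1"
  shows "euler_lagrange 4 2 (\<lambda>u. antideriv2 2 (\<lambda>w. exp (- R2 w)) u - antideriv2 1 f1 u
        + antideriv 0 f0 u + total_diff 2 N1 u) u =
     exp (- R2 u) * (u (VP 4) - (pdiff (VP 2) R2 u * (u (VP 3))\<^sup>2 + 2 * total_diff 2 R2 u * u (VP 3)
        - exp (R2 u) *
            (euler_lagrange 2 2 (antideriv2 2 (\<lambda>w. exp (- R2 w))) u
             + f1 u * u (VP 2) - euler_lagrange 1 1 (antideriv2 1 f1) u + f0 u)))"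
proof -
  define \<rho> where "\<rho> = (\<lambda>w. exp (- R2 w))"
  have \<rho>: "smooth \<rho>" "depends_upto 2 \<rho>"
    using R2 unfolding \<rho>_def by (auto intro: depends_upto_comp[where g = "\<lambda>x. exp (- x)"])
  have d\<rho>: "pdiff v \<rho> = (\<lambda>u. - (\<rho> u * pdiff v R2 u))" for v
    using R2 by (simp add: \<rho>_def pdiff_rules)
  have D\<rho>: "total_diff 2 \<rho> u = - (\<rho> u * total_diff 2 R2 u)"
    by (simp add: total_diff_def d\<rho> sum_negf sum_distrib_left algebra_simps)
  let ?S2 = "antideriv2 2 \<rho>" and ?S1 = "antideriv2 1 f1" and ?S0 = "antideriv 0 f0"
  note eqs = antideriv_eq antideriv2_eq
  have S: "smooth ?S2" "smooth ?S1" "smooth ?S0"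
    using \<rho> f1 f0 by (auto simp: eqs)
  have order: "depends_upto 2 ?S2" "depends_upto 1 ?S1" "depends_upto 0 ?S0"
    using \<rho> f1 f0 by (auto simp only: eqs intro: depends_upto_antiderivatives)
  have S2: "pdiff (VP 2) (pdiff (VP 2) ?S2) = \<rho>"
    and S1: "pdiff (VP 1) (pdiff (VP 1) ?S1) = f1"
    and S0: "pdiff (VP 0) ?S0 = f0"
    using \<rho> f1 f0 by (auto simp: eqs pdiff_primitive_in)
  have "total_diff 2 N1 = total_diff 4 N1"
    using total_diff_eq[OF N1(2), of 2] total_diff_eq[OF N1(2), of 4] by simp
  then have N: "euler_lagrange 4 2 (total_diff 2 N1) u = 0"
    using euler_lagrange_total_diff[OF N1] by simp
  have "euler_lagrange 4 2 (\<lambda>u. ?S2 u - ?S1 u + ?S0 u + total_diff 2 N1 u) u =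
      euler_lagrange 4 2 (\<lambda>u. ?S2 u + - ?S1 u + ?S0 u + total_diff 2 N1 u) u"
    by simp
  also have "\<dots> = euler_lagrange 4 2 ?S2 u - euler_lagrange 4 2 ?S1 u + euler_lagrange 4 2 ?S0 u"
    using S N1 N by (simp only: euler_lagrange_add euler_lagrange_uminus smooth_rules smooth_total_diff)
  also have "\<dots> = \<rho> u * u (VP 4) - \<rho> u * pdiff (VP 2) R2 u * (u (VP 3))\<^sup>2
      - 2 * (\<rho> u * total_diff 2 R2 u) * u (VP 3)
      + (euler_lagrange 2 2 ?S2 u + f1 u * u (VP 2) - euler_lagrange 1 1 ?S1 u + f0 u)"
    unfolding euler_lagrange_order_2[OF S(1) order(1)] euler_lagrange_order_1[OF order(2)]
      euler_lagrange_order_0[OF order(3)] S2 S1 S0 d\<rho> D\<rho>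
    by simp
  also have "\<dots> = \<rho> u * (u (VP 4) - (pdiff (VP 2) R2 u * (u (VP 3))\<^sup>2 + 2 * total_diff 2 R2 u * u (VP 3)
        - exp (R2 u) * (euler_lagrange 2 2 ?S2 u + f1 u * u (VP 2) - euler_lagrange 1 1 ?S1 u + f0 u)))"
  proof -
    have "\<rho> u * exp (R2 u) = 1"
      by (simp add: \<rho>_def flip: exp_add)
    then have cancel: "\<rho> u * (exp (R2 u) * x) = x" for x
      by (metis mult.assoc mult_1)
    show ?thesis
      by (simp only: right_diff_distrib distrib_left cancel)
  qed
  finally show ?thesis
    unfolding \<rho>_def .
qed

section \<open>Normal form of a Lagrangian of order two\<close>

text \<open>
  The difference of \<open>F\<close> and the double antiderivative has a \<open>v\<close>-derivative that does not depend on \<open>v\<close>,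
  hence is affine in \<open>v\<close>.
\<close>

lemma taylor_second_order:
  assumes "smooth F"
  shows "F u = primitive_in v (primitive_in v (pdiff v (pdiff v F))) u +
     u v * pdiff v F (u(v := 0)) + F (u(v := 0))"
proof -
  let ?J = "primitive_in v (primitive_in v (pdiff v (pdiff v F)))"
  have "pdiff v (\<lambda>u. F u - ?J u) = (\<lambda>u. pdiff v F (u(v := 0)))"
    using assms by (simp add: pdiff_rules pdiff_primitive_in primitive_in_pdiff)
  then have "primitive_in v (\<lambda>u. pdiff v F (u(v := 0))) u = F u - ?J u - F (u(v := 0))"
    using primitive_in_pdiff[of "\<lambda>u. F u - ?J u" v u] assms by (simp add: primitive_in_at_zero)
  then show ?thesis
    by (simp add: primitive_in_independent)
qed

text \<open>
  In the Taylor formula at \<open>p\<^bsub>k+1\<^esub> = 0\<close>, with linear coefficient \<open>A\<close> and constant term \<open>B\<close>, the linear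
  term is \<open>p\<^bsub>k+1\<^esub> A = D\<^bsub>k+1\<^esub> M - D\<^sub>k M\<close> with \<open>\<partial>\<^sub>k M = A\<close>, and \<open>D\<^sub>k M\<close> has order \<open>k\<close> only.
\<close>

lemma split_off_total_diff:
  assumes F: "smooth F" "depends_upto (Suc k) F"
  obtains M C where "smooth M" "depends_upto k M" "smooth C" "depends_upto k C"
    "F = (\<lambda>u. antideriv2 (Suc k) (pdiff (VP (Suc k)) (pdiff (VP (Suc k)) F)) u
        + total_diff (Suc k) M u + C u)"
proof -
  let ?v = "VP (Suc k)"
  define A where "A = (\<lambda>u. pdiff ?v F (u(?v := 0)))"
  define B where "B = (\<lambda>u. F (u(?v := 0)))"
  define M where "M = primitive_in (VP k) A"
  define C where "C = (\<lambda>u. B u - total_diff k M u)"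
  have A: "smooth A" "depends_upto k A"
    unfolding A_def using F
    by (simp_all only: smooth_freeze depends_upto_freeze_top smooth_pdiff depends_upto_pdiff)
  have B: "smooth B" "depends_upto k B"
    unfolding B_def using F by (simp_all only: smooth_freeze depends_upto_freeze_top)
  have M: "smooth M" "depends_upto k M"
    using A by (simp_all add: M_def depends_upto_antiderivatives)
  have C: "smooth C" "depends_upto k C"
    unfolding C_def using B M
    by (simp_all add: depends_upto_comp2[where g = "(-)"] depends_upto_total_diff)
  have "pdiff (VP k) M = A"
    using A by (simp add: M_def pdiff_primitive_in)
  then have "F u = antideriv2 (Suc k) (pdiff ?v (pdiff ?v F)) u + total_diff (Suc k) M u + C u" for u
    using taylor_second_order[OF F(1), of u ?v]
    by (simp add: antideriv2_eq total_diff_Suc C_def A_def B_def)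
  then show ?thesis
    using that[OF M C] by blast
qed

text \<open>
  The restriction of \<open>F\<close> to \<open>p\<^sub>0 = 0\<close> is a function of \<open>x\<close> alone, and its antiderivative in \<open>x\<close> has no
  other partial derivatives, so that every truncated total derivative returns it.
\<close>

lemma order_0_decomposition:
  assumes F: "smooth F" "depends_upto 0 F"
  obtains M where "smooth M" "depends_upto 0 M"
    "\<And>m. F = (\<lambda>u. antideriv 0 (pdiff (VP 0) F) u + total_diff m M u)"
proof -
  define G where "G = (\<lambda>u. F (u(VP 0 := 0)))"
  define M where "M = primitive_in VX G"
  have G: "smooth G" "depends_upto 0 G"
    unfolding G_def
    by (rule smooth_freeze[OF F(1)], rule depends_uptoI, rule depends_uptoD[OF F(2)]) auto
  have M: "smooth M" "depends_upto 0 M"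
    unfolding M_def using G(1) by simp (rule depends_upto_primitive_in[OF G(2)], simp)
  have "pdiff (VP i) M = (\<lambda>u. 0)" for i
  proof (cases i)
    case 0
    then show ?thesis
      using F G by (simp add: fun_eq_iff M_def pdiff_primitive_in)
        (simp add: G_def pdiff_freeze primitive_in_def)
  qed (use pdiff_eq_0[OF M(2)] in auto)
  then have "total_diff m M = G" for m
    using G by (simp add: M_def total_diff_def pdiff_primitive_in fun_eq_iff)
  then have "F = (\<lambda>u. antideriv 0 (pdiff (VP 0) F) u + total_diff m M u)" for m
    using F by (simp add: antideriv_eq primitive_in_pdiff G_def)
  then show ?thesis
    using that[OF M] by blast
qed

text \<open>
  Splitting off a total derivative at orders two and one and integrating the remainder of order zero.
  The three potentials add up to \<open>N\<close>, since on a function of order zero \<open>D\<^sub>1\<close> and \<open>D\<^sub>2\<close> agree.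
\<close>

lemma lagrangian_normal_form:
  assumes L: "smooth L" "depends_upto 2 L"
  obtains f0 f1 N where "smooth_fun 0 f0" "smooth_fun 1 f1" "smooth_fun 1 N"
    "L = (\<lambda>u. antideriv2 2 (pdiff (VP 2) (pdiff (VP 2) L)) u - antideriv2 1 f1 u
        + antideriv 0 f0 u + total_diff 2 N u)"
proof -
  obtain M1 C1 where M1: "smooth M1" "depends_upto 1 M1" and C1: "smooth C1" "depends_upto 1 C1"
    and L_eq: "L = (\<lambda>u. antideriv2 2 (pdiff (VP 2) (pdiff (VP 2) L)) u + total_diff 2 M1 u + C1 u)"
    using split_off_total_diff[of L 1] L by (metis Suc_1)
  obtain M0 C0 where M0: "smooth M0" "depends_upto 0 M0" and C0: "smooth C0" "depends_upto 0 C0"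
    and C1_eq: "C1 = (\<lambda>u. antideriv2 1 (pdiff (VP 1) (pdiff (VP 1) C1)) u + total_diff 1 M0 u + C0 u)"
    using split_off_total_diff[of C1 0] C1 by (metis One_nat_def)
  obtain M where M: "smooth M" "depends_upto 0 M"
    and C0_eq: "C0 = (\<lambda>u. antideriv 0 (pdiff (VP 0) C0) u + total_diff 2 M u)"
    using order_0_decomposition[OF C0] by metis
  define f0 where "f0 = pdiff (VP 0) C0"
  define f1 where "f1 = (\<lambda>u. - pdiff (VP 1) (pdiff (VP 1) C1) u)"
  define N where "N = (\<lambda>u. M1 u + M0 u + M u)"
  have "total_diff 1 M0 = total_diff 2 M0"
    using total_diff_eq[OF M0(2), of 1] total_diff_eq[OF M0(2), of 2] by simp
  then have N_eq: "total_diff 2 N u = total_diff 2 M1 u + total_diff 1 M0 u + total_diff 2 M u" for u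
    using M1 M0 M by (simp add: N_def total_diff_add)
  have "antideriv2 1 f1 u = - antideriv2 1 (pdiff (VP 1) (pdiff (VP 1) C1)) u" for u
    by (simp add: f1_def antideriv2_def interval_lebesgue_integral_uminus)
  then have "L u = antideriv2 2 (pdiff (VP 2) (pdiff (VP 2) L)) u - antideriv2 1 f1 u
        + antideriv 0 f0 u + total_diff 2 N u" for u
    using fun_cong[OF L_eq, of u] fun_cong[OF C1_eq, of u] fun_cong[OF C0_eq, of u] N_eq[of u]
    by (simp add: f0_def)
  moreover have "smooth_fun 0 f0" "smooth_fun 1 f1" "smooth_fun 1 N"
    using C0 C1 M1 M0 M
    by (auto simp: smooth_fun_iff f0_def f1_def N_def intro!: depends_upto_pdiff
      depends_upto_comp[where g = uminus] depends_upto_comp2[where g = "(+)"] intro: depends_upto_mono)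
  ultimately show ?thesis
    using that[of f0 f1 N] by blast
qed

text \<open>
  Only \<open>p\<^sub>4\<close> is varied: everything else in both sides is independent of it, so the two affine functions
  of \<open>p\<^sub>4\<close> have the same slope.
\<close>

lemma multiplier_eq_second_derivative:
  assumes L: "smooth L" "depends_upto 2 L" and \<rho>: "depends_upto 2 \<rho>" and f: "depends_upto 3 f"
    and eq: "\<And>u. \<rho> u * (u (VP 4) - f u) = euler_lagrange 4 2 L u"
  shows "\<rho> = pdiff (VP 2) (pdiff (VP 2) L)"
proof
  fix u
  let ?r = "pdiff (VP 2) (pdiff (VP 2) L)"
  let ?u = "\<lambda>t::real. u(VP 4 := t)"
  have indep: "F (?u t) = F u" if "depends_upto k F" "k \<le> 3" for F k t
    using that(2) by (intro depends_uptoD[OF that(1)]) auto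
  have r: "depends_upto 2 ?r"
    using L(2) by (intro depends_upto_pdiff)
  have *: "\<rho> u * (t - f u) = ?r u * t + pdiff (VP 2) ?r u * (u (VP 3))\<^sup>2
      + 2 * total_diff 2 ?r u * u (VP 3) + euler_lagrange 2 2 L u" for t
    using eq[of "?u t"] indep[OF \<rho>] indep[OF f] indep[OF r] indep[OF depends_upto_pdiff[OF r]]
      indep[OF depends_upto_total_diff[OF r]] indep[OF depends_upto_euler_lagrange[OF L(2)]]
    unfolding euler_lagrange_order_2[OF L] by simp
  from *[of 0] *[of 1] show "\<rho> u = ?r u"
    by (simp add: algebra_simps)
qed

theorem theorem1p2:
  "(\<forall>f3 L2 \<rho>2.
      smooth_fun 3 f3 \<and> smooth_fun 2 L2 \<and> smooth_fun 2 \<rho>2 \<and> (\<forall>u. \<rho>2 u > 0) \<and>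
      (\<forall>u. \<rho>2 u * (u (VP 4) - f3 u) = euler_lagrange 4 2 L2 u)
      \<longrightarrow> (\<exists>R2 f0 f1 N1.
            smooth_fun 2 R2 \<and> smooth_fun 0 f0 \<and> smooth_fun 1 f1 \<and> smooth_fun 1 N1 \<and>
            solution_system R2 f0 f1 N1 f3 \<rho>2 L2))
   \<and>
   (\<forall>R2 f0 f1 N1 f3 \<rho>2 L2.
      smooth_fun 2 R2 \<and> smooth_fun 0 f0 \<and> smooth_fun 1 f1 \<and> smooth_fun 1 N1 \<and>
      solution_system R2 f0 f1 N1 f3 \<rho>2 L2
      \<longrightarrow> smooth_fun 3 f3 \<and> smooth_fun 2 L2 \<and> smooth_fun 2 \<rho>2 \<and> (\<forall>u. \<rho>2 u > 0) \<and>
          (\<forall>u. \<rho>2 u * (u (VP 4) - f3 u) = euler_lagrange 4 2 L2 u))"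
proof (intro conjI allI impI; elim conjE)
  fix f3 L2 \<rho>2
  assume f3: "smooth_fun 3 f3" and L2: "smooth_fun 2 L2" and \<rho>2: "smooth_fun 2 \<rho>2"
    and pos: "\<forall>u. \<rho>2 u > 0"
    and eq: "\<forall>u. \<rho>2 u * (u (VP 4) - f3 u) = euler_lagrange 4 2 L2 u"
  define R2 where "R2 = (\<lambda>u. - ln (\<rho>2 u))"
  have \<rho>2_eq: "\<rho>2 = (\<lambda>u. exp (- R2 u))"
    using pos by (simp add: R2_def)
  have R2: "smooth_fun 2 R2"
    using \<rho>2 pos unfolding smooth_fun_iff R2_def
    by (simp add: depends_upto_comp[where g = "\<lambda>x. - ln x"])
  have L2': "smooth L2" "depends_upto 2 L2"
    using L2 by (simp_all add: smooth_fun_iff)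
  obtain f0 f1 N1 where f: "smooth_fun 0 f0" "smooth_fun 1 f1" "smooth_fun 1 N1"
    and L2_decomp: "L2 = (\<lambda>u. antideriv2 2 (pdiff (VP 2) (pdiff (VP 2) L2)) u - antideriv2 1 f1 u
        + antideriv 0 f0 u + total_diff 2 N1 u)"
    by (rule lagrangian_normal_form[OF L2'])
  have "\<rho>2 = pdiff (VP 2) (pdiff (VP 2) L2)"
    using \<rho>2 f3 eq by (intro multiplier_eq_second_derivative[OF L2', where f = f3]) (simp_all add: smooth_fun_iff)
  then have d: "pdiff (VP 2) (pdiff (VP 2) L2) = (\<lambda>w. exp (- R2 w))"
    using \<rho>2_eq by simp
  note L2_eq = L2_decomp[unfolded d]
  have "f3 u = pdiff (VP 2) R2 u * (u (VP 3))\<^sup>2 + 2 * total_diff 2 R2 u * u (VP 3)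
        - exp (R2 u) * (euler_lagrange 2 2 (antideriv2 2 (\<lambda>w. exp (- R2 w))) u
             + f1 u * u (VP 2) - euler_lagrange 1 1 (antideriv2 1 f1) u + f0 u)" (is "_ = ?f") for u
  proof -
    have "euler_lagrange 4 2 L2 u = \<rho>2 u * (u (VP 4) - ?f)"
      using R2 f unfolding L2_eq \<rho>2_eq smooth_fun_iff by (intro euler_lagrange_solution) auto
    then have "\<rho>2 u * (u (VP 4) - f3 u) = \<rho>2 u * (u (VP 4) - ?f)"
      using eq by simp
    moreover have "\<rho>2 u \<noteq> 0"
      using pos by (metis less_irrefl)
    ultimately show ?thesis
      by (simp only: mult_cancel_left) simp
  qed
  then have "solution_system R2 f0 f1 N1 f3 \<rho>2 L2"
    unfolding solution_system_def using fun_cong[OF \<rho>2_eq] fun_cong[OF L2_eq] by blast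
  with R2 f show "\<exists>R2 f0 f1 N1. smooth_fun 2 R2 \<and> smooth_fun 0 f0 \<and> smooth_fun 1 f1 \<and> smooth_fun 1 N1 \<and>
            solution_system R2 f0 f1 N1 f3 \<rho>2 L2"
    by blast
next
  fix R2 f0 f1 N1 f3 \<rho>2 L2
  assume R2: "smooth_fun 2 R2" and f: "smooth_fun 0 f0" "smooth_fun 1 f1" "smooth_fun 1 N1"
    and sol: "solution_system R2 f0 f1 N1 f3 \<rho>2 L2"
  have f3_eq: "f3 = (\<lambda>u. pdiff (VP 2) R2 u * (u (VP 3))\<^sup>2 + 2 * total_diff 2 R2 u * u (VP 3)
        - exp (R2 u) * (euler_lagrange 2 2 (antideriv2 2 (\<lambda>w. exp (- R2 w))) u
             + f1 u * u (VP 2) - euler_lagrange 1 1 (antideriv2 1 f1) u + f0 u))"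
    and \<rho>2_eq: "\<rho>2 = (\<lambda>u. exp (- R2 u))"
    and L2_eq: "L2 = (\<lambda>u. antideriv2 2 (\<lambda>w. exp (- R2 w)) u - antideriv2 1 f1 u
        + antideriv 0 f0 u + total_diff 2 N1 u)"
    using sol by (simp_all add: solution_system_def fun_eq_iff)
  have smooth: "smooth R2" "smooth f0" "smooth f1" "smooth N1"
    and order: "depends_upto 2 R2" "depends_upto 0 f0" "depends_upto 1 f1" "depends_upto 1 N1"
    using R2 f by (auto simp: smooth_fun_iff)
  have \<rho>2: "depends_upto 2 (\<lambda>u. exp (- R2 u))"
    using order by (intro depends_upto_comp[where g = "\<lambda>x. exp (- x)"])
  note S2 = depends_upto_antiderivatives(2)[OF \<rho>2, folded antideriv2_eq]
  note S1 = depends_upto_antiderivatives(2)[OF order(3), folded antideriv2_eq]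
  note S0 = depends_upto_antiderivatives(1)[OF order(2), folded antideriv_eq]
  have N1: "depends_upto 2 N1"
    using order(4) by (rule depends_upto_mono) simp
  show "smooth_fun 2 \<rho>2"
    using smooth(1) \<rho>2 unfolding \<rho>2_eq smooth_fun_iff by auto
  show "0 < \<rho>2 u" for u
    by (simp add: \<rho>2_eq)
  show "smooth_fun 2 L2"
    unfolding smooth_fun_iff
  proof
    show "depends_upto 2 L2"
      unfolding L2_eq
      by (intro depends_upto_comp2[where g = "(+)"] depends_upto_comp2[where g = "(-)"]
          S2 depends_upto_mono[OF S1] depends_upto_mono[OF S0] depends_upto_total_diff N1) auto
    show "smooth L2"
      unfolding L2_eq antideriv_eq antideriv2_eq using smooth by auto
  qed
  show "smooth_fun 3 f3"
    unfolding smooth_fun_iff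
  proof
    have order_3: "depends_upto 3 F" if "depends_upto k F" "k \<le> 3" for k F
      using that by (rule depends_upto_mono)
    show "depends_upto 3 f3"
      unfolding f3_eq power2_eq_square
      by (intro depends_upto_comp2[where g = "(+)"] depends_upto_comp2[where g = "(-)"]
          depends_upto_comp2[where g = "(*)"] depends_upto_comp[where g = exp] depends_upto_VP depends_upto_const
          order_3[OF depends_upto_pdiff[OF order(1)]] order_3[OF depends_upto_total_diff[OF order(1)]]
          order_3[OF order(1)] order_3[OF order(2)] order_3[OF order(3)]
          order_3[OF depends_upto_euler_lagrange[OF S2]] order_3[OF depends_upto_euler_lagrange[OF S1]]) auto
    show "smooth f3"
      unfolding f3_eq antideriv_eq antideriv2_eq using smooth by auto
  qed
  show "\<rho>2 u * (u (VP 4) - f3 u) = euler_lagrange 4 2 L2 u" for u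
    unfolding L2_eq \<rho>2_eq f3_eq using smooth order by (intro euler_lagrange_solution[symmetric])
qed

end
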